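(* Let $n\ge 2$ and $1\le k\le n-1$ be integers, and let $V$ be an $n$-dimensional real vector space. For each integer $m\ge 2$, let $P(m)$ be the set of $\mathbb{R}^m$-valued $k$-plectic forms on $V$. For $p,q\ge 2$ and $i\in\{1,\dots,p\}$ let $\circ_i:P(p)\times P(q)\to P(p+q-1)$ be defined by: for $\beta=(\beta_1,\dots,\beta_p)^T\in P(p)$ and $\alpha=(\alpha_1,\dots,\alpha_q)^T\in P(q)$, $$\beta\circ_i\alpha=(\beta_1,\dots,\beta_{i-1},\alpha_1,\dots,\alpha_q,\beta_{i+1},\dots,\beta_p)^T .$$ For $\alpha\in P(q)$ and a choice of $v_1,\dots,v_{k+1}\in V$ such that $\alpha_j(v_1,\dots,v_{k+1})\ne 0$ for each $j\in\{1,\dots,q\}$, define $$E(\alpha)=-\sum_{j=1}^q\frac{(\alpha_j(v_1,\dots,v_{k+1}))^2}{\sum_{i=1}^q(\alpha_i(v_1,\dots,v_{k+1}))^2}\,\ln\frac{(\alpha_j(v_1,\dots,v_{k+1}))^2}{\sum_{i=1}^q(\alpha_i(v_1,\dots,v_{k+1}))^2}$$ (the choice of $v_1,\dots,v_{k+1}$ is suppressed in the notation; within each of the statements below the same choice is used for all values of $E$). Then: (a) the sets $P(m)$, $m\ge 2$, and the compositions $\circ_i$ define a non-unital operad (with $\Sigma_m$ acting on $P(m)$ by permuting components); in particular each $\circ_i$ is well defined, i.e. $\beta\circ_i\alpha\in P(p+q-1)$. (b) For every $\alpha\in P(q)$, every $i\in\{1,\dots,q\}$ and every choice of $v_1,\dots,v_{k+1}\in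 V$ such that $\alpha_j(v_1,\dots,v_{k+1})\ne 0$ for each $j\in\{1,\dots,q\}$, $$E(\alpha\circ_i\alpha)\le 2E(\alpha)+\ln 2 .$$ (c) Let $\beta\in P(p)$, $\alpha\in P(q)$, $i\in\{1,\dots,p\}$, and let $v_1,\dots,v_{k+1}\in V$ be such that $B_j:=(\beta_j(v_1,\dots,v_{k+1}))^2\ne 0$ for each $j\in\{1,\dots,p\}$, $A_j:=(\alpha_j(v_1,\dots,v_{k+1}))^2\ne 0$ for each $j\in\{1,\dots,q\}$, and $B_i=A:=\sum_{j=1}^qA_j$. Then $$E(\beta\circ_i\alpha)=E(\beta)+\frac{A}{B}E(\alpha),\qquad\text{where } B=\sum_{j=1}^pB_j .$$ (d) For $\gamma^{(q)}=(\gamma,\dots,\gamma)^T\in P(q)$ (all $q$ components equal to the same $(k+1)$-form $\gamma$) and a choice of $v_1,\dots,v_{k+1}\in V$ such that $\gamma(v_1,\dots,v_{k+1})=c\ne 0$, $$E(\gamma^{(q)})=\ln q .$$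
   Context: An $\mathbb{R}^m$-valued $k$-plectic form on $V$ is an alternating $(k+1)$-linear map $\omega:\bigwedge^{k+1}V\to\mathbb{R}^m$ that is nondegenerate: if $v\in V$ satisfies $\omega(v,u_1,\dots,u_k)=0\in\mathbb{R}^m$ for all $u_1,\dots,u_k\in V$, then $v=0$. Its components are denoted $\omega_1,\dots,\omega_m$ and $\omega$ is written as the column $(\omega_1,\dots,\omega_m)^T$. A non-unital operad (indexed by integers $\ge 2$) is a collection of sets $P(m)$, $m\ge 2$, with a (right) action of the symmetric group $\Sigma_m$ on $P(m)$, and partial compositions $\circ_i:P(p)\times P(q)\to P(p+q-1)$, $1\le i\le p$, such that: (i) (equivariance) for $\beta\in P(p)$, $\alpha\in P(q)$, $1\le i\le p$: for $\sigma\in\Sigma_q$, $\beta\circ_i(\alpha\sigma)=(\beta\circ_i\alpha)\sigma'$, where $\sigma'\in\Sigma_{p+q-1}$ acts as $\sigma$ on the block of positions $i,\dots,i+q-1$ and as the identity elsewhere; and for $\sigma\in\Sigma_p$, $(\beta\sigma)\circ_i\alpha=(\beta\circ_{\sigma(i)}\alpha)\sigma''$, where $\sigma''\in\Sigma_{p+q-1}$ is the block permutation which acts like $\sigma$ on $p$ consecutive blocks (the $i$-th block of size $q$, the others of size $1$; the $j$-th block is sent to the $\sigma(j)$-th block of the subdivision whose $\sigma(i)$-th block has size $q$ and whose other blocks have size $1$), preserving order within blocks. (ii) (associativity) for $f\in P(l)$, $g\in P(m)$, $h\in P(r)$: $(f\circ_k h)\circ_i g=(f\circ_i g)\circ_{k-1+m}h$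 for $1\le i<k\le l$ (here $k$ is just an index); and $f\circ_i(g\circ_j h)=(f\circ_i g)\circ_{i-1+j}h$ for $1\le i\le l$, $1\le j\le m$. The symmetric group action on $P(m)$ is the permutation of components: $(\alpha\sigma)_j=\alpha_{\sigma(j)}$ for $\sigma\in\Sigma_m$. *)

theory Defs
  imports "HOL-Combinatorics.Permutations" "HOL-Library.FuncSet" Complex_Main
begin

text \<open>
  The Euclidean space of dimension \<open>m\<close> is represented by the functions on \<open>{1..m}\<close> that are
  undefined elsewhere, and the argument tuples of a form by the lists of length \<open>k + 1\<close>.  Forms
  are undefined on lists of any other length, so that equality of functions is equality of forms.
\<close>

definition real_space :: "nat \<Rightarrow> (nat \<Rightarrow> real) set" where
  "real_space m = {1..m} \<rightarrow>\<^sub>E UNIV"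

definition real_space_zero :: "nat \<Rightarrow> nat \<Rightarrow> real" where
  "real_space_zero m = (\<lambda>j\<in>{1..m}. 0)"

definition tuples :: "nat \<Rightarrow> 'v list set" where
  "tuples r = {vs. length vs = r}"

text \<open>Linearity of a map into the space of dimension \<open>m\<close>, whose operations are componentwise.\<close>

definition linear_into :: "nat \<Rightarrow> ('v::real_vector \<Rightarrow> nat \<Rightarrow> real) \<Rightarrow> bool" where
  "linear_into m f \<longleftrightarrow> (\<forall>j\<in>{1..m}. linear (\<lambda>v. f v j))"

definition multilinear_map :: "nat \<Rightarrow> nat \<Rightarrow> ('v::real_vector list \<Rightarrow> nat \<Rightarrow> real) \<Rightarrow> bool" where
  "multilinear_map r m \<omega> \<longleftrightarrow>
     (\<forall>vs\<in>tuples r. \<forall>l<r. linear_into m (\<lambda>v. \<omega> (vs[l := v])))"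

definition alternating_map :: "nat \<Rightarrow> nat \<Rightarrow> ('v list \<Rightarrow> nat \<Rightarrow> real) \<Rightarrow> bool" where
  "alternating_map r m \<omega> \<longleftrightarrow>
     (\<forall>vs\<in>tuples r. \<forall>a<r. \<forall>b<r. a \<noteq> b \<and> vs ! a = vs ! b \<longrightarrow> \<omega> vs = real_space_zero m)"

definition nondegenerate :: "nat \<Rightarrow> nat \<Rightarrow> ('v::zero list \<Rightarrow> nat \<Rightarrow> real) \<Rightarrow> bool" where
  "nondegenerate k m \<omega> \<longleftrightarrow>
     (\<forall>v. (\<forall>us\<in>tuples k. \<omega> (v # us) = real_space_zero m) \<longrightarrow> v = 0)"

definition plectic_forms :: "nat \<Rightarrow> nat \<Rightarrow> ('v::real_vector list \<Rightarrow> nat \<Rightarrow> real) set" where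
  "plectic_forms k m =
     {\<omega> \<in> tuples (k + 1) \<rightarrow>\<^sub>E real_space m.
        multilinear_map (k + 1) m \<omega> \<and> alternating_map (k + 1) m \<omega> \<and> nondegenerate k m \<omega>}"

text \<open>
  \<open>local_perm i q \<sigma>\<close> acts as \<open>\<sigma>\<close> on the positions \<open>i, \<dots>, i + q - 1\<close>.
\<close>

definition local_perm :: "nat \<Rightarrow> nat \<Rightarrow> (nat \<Rightarrow> nat) \<Rightarrow> nat \<Rightarrow> nat" where
  "local_perm i q \<sigma> t = (if i \<le> t \<and> t < i + q then \<sigma> (t - i + 1) + i - 1 else t)"

text \<open>
  Consider the subdivision of the positions \<open>1, 2, \<dots>\<close> into consecutive blocks, the \<open>i\<close>-th of size
  \<open>q\<close> and all others of size 1.  Then \<open>block_of i q t\<close> is the number of the block containing \<open>t\<close>,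
  and \<open>block_start i q j\<close> is the first position of the \<open>j\<close>-th block.
\<close>

definition block_of :: "nat \<Rightarrow> nat \<Rightarrow> nat \<Rightarrow> nat" where
  "block_of i q t = (if t < i then t else if t < i + q then i else t - q + 1)"

definition block_start :: "nat \<Rightarrow> nat \<Rightarrow> nat \<Rightarrow> nat" where
  "block_start i q j = (if j \<le> i then j else j + q - 1)"

text \<open>
  Position \<open>t\<close> in block \<open>j\<close> goes to the same relative position in block \<open>\<sigma> j\<close> of the subdivision
  whose \<open>\<sigma> i\<close>-th block has size \<open>q\<close>.  If \<open>\<sigma>\<close> permutes \<open>{1..p}\<close> and \<open>1 \<le> i \<le> p\<close>, this
  fixes all \<open>t\<close> outside \<open>{1..p + q - 1}\<close>, because \<open>\<sigma>\<close> fixes everything outside \<open>{1..p}\<close>.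
\<close>

definition block_perm :: "nat \<Rightarrow> nat \<Rightarrow> (nat \<Rightarrow> nat) \<Rightarrow> nat \<Rightarrow> nat" where
  "block_perm i q \<sigma> t =
     (let j = block_of i q t in block_start (\<sigma> i) q (\<sigma> j) + (t - block_start i q j))"

text \<open>
  In a non-unital operad, \<open>act m \<alpha> \<sigma>\<close> is the right action of \<open>\<sigma>\<close> on \<open>\<alpha> \<in> P m\<close>, and
  \<open>cmp p q i \<beta> \<alpha>\<close> is the \<open>i\<close>-th partial composition of \<open>\<beta> \<in> P p\<close> with \<open>\<alpha> \<in> P q\<close>.
\<close>

locale non_unital_operad =
  fixes P :: "nat \<Rightarrow> 'a set"
    and act :: "nat \<Rightarrow> 'a \<Rightarrow> (nat \<Rightarrow> nat) \<Rightarrow> 'a"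
    and cmp :: "nat \<Rightarrow> nat \<Rightarrow> nat \<Rightarrow> 'a \<Rightarrow> 'a \<Rightarrow> 'a"
  assumes act_closed:
      "\<lbrakk>m \<ge> 2; \<alpha> \<in> P m; \<sigma> permutes {1..m}\<rbrakk> \<Longrightarrow> act m \<alpha> \<sigma> \<in> P m"
    and act_id:
      "\<lbrakk>m \<ge> 2; \<alpha> \<in> P m\<rbrakk> \<Longrightarrow> act m \<alpha> id = \<alpha>"
    and act_comp:
      "\<lbrakk>m \<ge> 2; \<alpha> \<in> P m; \<sigma> permutes {1..m}; \<tau> permutes {1..m}\<rbrakk>
        \<Longrightarrow> act m \<alpha> (\<sigma> \<circ> \<tau>) = act m (act m \<alpha> \<sigma>) \<tau>"
    and cmp_closed:
      "\<lbrakk>p \<ge> 2; q \<ge> 2; 1 \<le> i; i \<le> p; \<beta> \<in> P p; \<alpha> \<in> P q\<rbrakk>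
        \<Longrightarrow> cmp p q i \<beta> \<alpha> \<in> P (p + q - 1)"
    and equivariance_right:
      "\<lbrakk>p \<ge> 2; q \<ge> 2; 1 \<le> i; i \<le> p; \<beta> \<in> P p; \<alpha> \<in> P q; \<sigma> permutes {1..q}\<rbrakk>
        \<Longrightarrow> cmp p q i \<beta> (act q \<alpha> \<sigma>) = act (p + q - 1) (cmp p q i \<beta> \<alpha>) (local_perm i q \<sigma>)"
    and equivariance_left:
      "\<lbrakk>p \<ge> 2; q \<ge> 2; 1 \<le> i; i \<le> p; \<beta> \<in> P p; \<alpha> \<in> P q; \<sigma> permutes {1..p}\<rbrakk>
        \<Longrightarrow> cmp p q i (act p \<beta> \<sigma>) \<alpha> = act (p + q - 1) (cmp p q (\<sigma> i) \<beta> \<alpha>) (block_perm i q \<sigma>)"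
    and assoc_parallel:
      "\<lbrakk>l \<ge> 2; m \<ge> 2; r \<ge> 2; 1 \<le> i; i < k; k \<le> l; f \<in> P l; g \<in> P m; h \<in> P r\<rbrakk>
        \<Longrightarrow> cmp (l + r - 1) m i (cmp l r k f h) g
            = cmp (l + m - 1) r (k - 1 + m) (cmp l m i f g) h"
    and assoc_sequential:
      "\<lbrakk>l \<ge> 2; m \<ge> 2; r \<ge> 2; 1 \<le> i; i \<le> l; 1 \<le> j; j \<le> m; f \<in> P l; g \<in> P m; h \<in> P r\<rbrakk>
        \<Longrightarrow> cmp l (m + r - 1) i f (cmp m r j g h)
            = cmp (l + m - 1) r (i - 1 + j) (cmp l m i f g) h"

definition permute_components ::
    "nat \<Rightarrow> nat \<Rightarrow> ('v list \<Rightarrow> nat \<Rightarrow> real) \<Rightarrow> (nat \<Rightarrow> nat) \<Rightarrow> 'v list \<Rightarrow> nat \<Rightarrow> real" where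
  "permute_components k m \<alpha> \<sigma> = (\<lambda>vs\<in>tuples (k + 1). \<lambda>j\<in>{1..m}. \<alpha> vs (\<sigma> j))"

definition insert_components ::
    "nat \<Rightarrow> nat \<Rightarrow> nat \<Rightarrow> nat \<Rightarrow> ('v list \<Rightarrow> nat \<Rightarrow> real) \<Rightarrow> ('v list \<Rightarrow> nat \<Rightarrow> real)
      \<Rightarrow> 'v list \<Rightarrow> nat \<Rightarrow> real" where
  "insert_components k p q i \<beta> \<alpha> =
     (\<lambda>vs\<in>tuples (k + 1). \<lambda>t\<in>{1..p + q - 1}.
        if t < i then \<beta> vs t
        else if t < i + q then \<alpha> vs (t - i + 1)
        else \<beta> vs (t - q + 1))"

definition constant_column :: "nat \<Rightarrow> nat \<Rightarrow> ('v list \<Rightarrow> real) \<Rightarrow> 'v list \<Rightarrow> nat \<Rightarrow> real" where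
  "constant_column k q \<gamma> = (\<lambda>vs\<in>tuples (k + 1). \<lambda>j\<in>{1..q}. \<gamma> vs)"

definition entropy :: "nat \<Rightarrow> ('v list \<Rightarrow> nat \<Rightarrow> real) \<Rightarrow> 'v list \<Rightarrow> real" where
  "entropy q \<alpha> vs =
     - (\<Sum>j=1..q. (\<alpha> vs j)\<^sup>2 / (\<Sum>i=1..q. (\<alpha> vs i)\<^sup>2)
                    * ln ((\<alpha> vs j)\<^sup>2 / (\<Sum>i=1..q. (\<alpha> vs i)\<^sup>2)))"

end

theory Submission
  imports Defs
begin

text \<open>
  Every component of \<open>\<alpha>\<close> occurs in \<open>\<beta> \<circ>\<^sub>i \<alpha>\<close>, so nondegeneracy of \<open>\<alpha>\<close> alone makes the composition
  nondegenerate; the operad axioms then are identities between index maps.  For the entropy, put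
  \<open>W = \<Sum>w\<^sub>j\<close> for positive weights \<open>w\<^sub>j\<close>; then
  \<open>E = ln W - (\<Sum>w\<^sub>j ln w\<^sub>j) / W\<close>, and composition replaces the term of \<open>\<beta>\<^sub>i\<close> in both sums by the
  sums over \<open>\<alpha>\<close>.  In (c) the total weight does not change.  In (b), with \<open>x\<close> the \<open>i\<close>-th weight and
  \<open>S\<close> the total weight of \<open>\<alpha>\<close>, the new total weight is \<open>T = 2S - x\<close> with \<open>S \<le> T \<le> 2S\<close>, and
  \<open>E(\<alpha> \<circ>\<^sub>i \<alpha>) = ln (T / S) + 2 (S / T) E(\<alpha>) + (x / T) ln (x / S)\<close>.
\<close>

subsection \<open>Forms through their components\<close>

text \<open>Multilinearity and alternation constrain each component separately; nondegeneracy is the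
  only condition that couples components. This scalar notion collects the separate part.\<close>

definition alternating_form :: "nat \<Rightarrow> ('v::real_vector list \<Rightarrow> real) \<Rightarrow> bool" where
  "alternating_form r f \<longleftrightarrow>
     (\<forall>vs\<in>tuples r. (\<forall>l<r. linear (\<lambda>v. f (vs[l := v]))) \<and>
        (\<forall>a<r. \<forall>b<r. a \<noteq> b \<and> vs ! a = vs ! b \<longrightarrow> f vs = 0))"

lemma tuples_update [simp]: "vs \<in> tuples r \<Longrightarrow> vs[l := v] \<in> tuples r"
  by (simp add: tuples_def)

lemma alternating_form_cong:
  assumes "\<And>vs. vs \<in> tuples r \<Longrightarrow> f vs = g vs"
  shows "alternating_form r f \<longleftrightarrow> alternating_form r g"
  using assms by (simp add: alternating_form_def)

lemma eq_real_space_zero_iff: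
  assumes "x \<in> real_space m"
  shows "x = real_space_zero m \<longleftrightarrow> (\<forall>j\<in>{1..m}. x j = 0)"
  using assms
  by (auto simp: real_space_def real_space_zero_def fun_eq_iff PiE_def extensional_def)

text \<open>Values lie in \<open>real_space m\<close>, hence agree with the zero vector off
  \<open>{1..m}\<close>, so vanishing is tested componentwise.\<close>

lemma plectic_forms_iff:
  "\<omega> \<in> plectic_forms k m \<longleftrightarrow>
     \<omega> \<in> tuples (k + 1) \<rightarrow>\<^sub>E real_space m \<and>
     (\<forall>j\<in>{1..m}. alternating_form (k + 1) (\<lambda>vs. \<omega> vs j)) \<and>
     (\<forall>v. (\<forall>us\<in>tuples k. \<forall>j\<in>{1..m}. \<omega> (v # us) j = 0) \<longrightarrow> v = 0)"
proof (cases "\<omega> \<in> tuples (k + 1) \<rightarrow>\<^sub>E real_space m")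
  case True
  have zero: "\<omega> vs = real_space_zero m \<longleftrightarrow> (\<forall>j\<in>{1..m}. \<omega> vs j = 0)"
    if "vs \<in> tuples (k + 1)" for vs
    using True that by (intro eq_real_space_zero_iff) auto
  have zero_Cons: "\<omega> (v # us) = real_space_zero m \<longleftrightarrow> (\<forall>j\<in>{1..m}. \<omega> (v # us) j = 0)"
    if "us \<in> tuples k" for v us
    using that by (intro zero) (simp add: tuples_def)
  have "alternating_map (k + 1) m \<omega> \<longleftrightarrow>
      (\<forall>vs\<in>tuples (k + 1). \<forall>a<k + 1. \<forall>b<k + 1. a \<noteq> b \<and> vs ! a = vs ! b \<longrightarrow>
        (\<forall>j\<in>{1..m}. \<omega> vs j = 0))"
    unfolding alternating_map_def using zero by (intro ball_cong refl) simp
  moreover have "multilinear_map (k + 1) m \<omega> \<longleftrightarrow>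
      (\<forall>j\<in>{1..m}. \<forall>vs\<in>tuples (k + 1). \<forall>l<k + 1. linear (\<lambda>v. \<omega> (vs[l := v]) j))"
    unfolding multilinear_map_def linear_into_def by blast
  moreover have "(\<forall>j\<in>{1..m}. alternating_form (k + 1) (\<lambda>vs. \<omega> vs j)) \<longleftrightarrow>
      (\<forall>j\<in>{1..m}. \<forall>vs\<in>tuples (k + 1). \<forall>l<k + 1. linear (\<lambda>v. \<omega> (vs[l := v]) j)) \<and>
      (\<forall>vs\<in>tuples (k + 1). \<forall>a<k + 1. \<forall>b<k + 1. a \<noteq> b \<and> vs ! a = vs ! b \<longrightarrow>
        (\<forall>j\<in>{1..m}. \<omega> vs j = 0))"
    unfolding alternating_form_def by blast
  moreover have "nondegenerate k m \<omega> \<longleftrightarrow>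
      (\<forall>v. (\<forall>us\<in>tuples k. \<forall>j\<in>{1..m}. \<omega> (v # us) j = 0) \<longrightarrow> v = 0)"
    unfolding nondegenerate_def using zero_Cons by simp
  ultimately show ?thesis
    using True by (simp only: plectic_forms_def mem_Collect_eq simp_thms conj_assoc)
qed (simp add: plectic_forms_def)

text \<open>A vector annihilated by all components of \<open>\<omega>'\<close> is annihilated by all
  components of \<open>\<omega>\<close>, since these occur among them. Both closure properties of
  the operad reduce to this.\<close>

lemma plectic_forms_extend:
  assumes \<omega>: "\<omega> \<in> plectic_forms k q"
    and \<omega>': "\<omega>' \<in> tuples (k + 1) \<rightarrow>\<^sub>E real_space m"
    and alt: "\<And>t. t \<in> {1..m} \<Longrightarrow> alternating_form (k + 1) (\<lambda>vs. \<omega>' vs t)"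
    and occurs: "\<And>j. j \<in> {1..q} \<Longrightarrow> \<exists>t\<in>{1..m}. \<forall>vs\<in>tuples (k + 1). \<omega>' vs t = \<omega> vs j"
  shows "\<omega>' \<in> plectic_forms k m"
proof -
  have "v = 0" if "\<forall>us\<in>tuples k. \<forall>t\<in>{1..m}. \<omega>' (v # us) t = 0" for v
  proof -
    note vanish = that
    have "\<omega> (v # us) j = 0" if us: "us \<in> tuples k" and j: "j \<in> {1..q}" for us j
    proof -
      have "v # us \<in> tuples (k + 1)"
        using us by (simp add: tuples_def)
      with occurs[OF j] obtain t where "t \<in> {1..m}" "\<omega>' (v # us) t = \<omega> (v # us) j"
        by blast
      then show ?thesis
        using vanish us by auto
    qed
    then show ?thesis
      using \<omega> unfolding plectic_forms_iff by blast
  qed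
  then show ?thesis
    using \<omega>' alt unfolding plectic_forms_iff by blast
qed

lemma alternating_form_component:
  "\<omega> \<in> plectic_forms k m \<Longrightarrow> j \<in> {1..m} \<Longrightarrow> alternating_form (k + 1) (\<lambda>vs. \<omega> vs j)"
  unfolding plectic_forms_iff by blast

text \<open>The two default-value facts make the action of the identity return the very same
  function, not merely one agreeing on the relevant arguments.\<close>

lemma plectic_form_outside_tuples:
  "\<omega> \<in> plectic_forms k m \<Longrightarrow> vs \<notin> tuples (k + 1) \<Longrightarrow> \<omega> vs = undefined"
  unfolding plectic_forms_def by (blast dest: PiE_arb)

lemma plectic_form_outside_index:
  "\<omega> \<in> plectic_forms k m \<Longrightarrow> vs \<in> tuples (k + 1) \<Longrightarrow> j \<notin> {1..m} \<Longrightarrow> \<omega> vs j = undefined"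
  unfolding plectic_forms_def real_space_def by (blast dest: PiE_arb PiE_mem)

subsection \<open>The operad\<close>

lemma permute_components_closed:
  assumes \<alpha>: "\<alpha> \<in> plectic_forms k m" and \<sigma>: "\<sigma> permutes {1..m}"
  shows "permute_components k m \<alpha> \<sigma> \<in> plectic_forms k m"
proof (rule plectic_forms_extend[OF \<alpha>])
  show "permute_components k m \<alpha> \<sigma> \<in> tuples (k + 1) \<rightarrow>\<^sub>E real_space m"
    by (auto simp: permute_components_def real_space_def)
  fix j assume j: "j \<in> {1..m}"
  have "alternating_form (k + 1) (\<lambda>vs. \<alpha> vs (\<sigma> j))"
    using \<alpha> j permutes_in_image[OF \<sigma>] by (intro alternating_form_component) auto
  then show "alternating_form (k + 1) (\<lambda>vs. permute_components k m \<alpha> \<sigma> vs j)"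
    using j by (subst alternating_form_cong[where g = "\<lambda>vs. \<alpha> vs (\<sigma> j)"])
      (auto simp: permute_components_def)
  show "\<exists>t\<in>{1..m}. \<forall>vs\<in>tuples (k + 1). permute_components k m \<alpha> \<sigma> vs t = \<alpha> vs j"
  proof
    \<comment> \<open>Position \<open>t\<close> of the permuted column holds component
      \<open>\<sigma> t\<close>, so component \<open>j\<close> is found at
      \<open>inv \<sigma> j\<close>.\<close>
    show *: "inv \<sigma> j \<in> {1..m}"
      using j permutes_in_image[OF permutes_inv[OF \<sigma>]] by simp
    show "\<forall>vs\<in>tuples (k + 1). permute_components k m \<alpha> \<sigma> vs (inv \<sigma> j) = \<alpha> vs j"
      using * permutes_inverses(1)[OF \<sigma>] by (simp add: permute_components_def)
  qed
qed

lemma insert_components_closed: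
  assumes \<beta>: "\<beta> \<in> plectic_forms k p" and \<alpha>: "\<alpha> \<in> plectic_forms k q" and i: "1 \<le> i" "i \<le> p"
  shows "insert_components k p q i \<beta> \<alpha> \<in> plectic_forms k (p + q - 1)"
proof (rule plectic_forms_extend[OF \<alpha>])
  show "insert_components k p q i \<beta> \<alpha> \<in> tuples (k + 1) \<rightarrow>\<^sub>E real_space (p + q - 1)"
    by (auto simp: insert_components_def real_space_def)
next
  fix t assume t: "t \<in> {1..p + q - 1}"
  \<comment> \<open>The case distinction depends on \<open>t\<close> only; outside the abstraction
    over \<open>vs\<close>, each branch is a single component of \<open>\<beta>\<close> or
    \<open>\<alpha>\<close>.\<close>
  define g where "g = (if t < i then (\<lambda>vs. \<beta> vs t)
    else if t < i + q then (\<lambda>vs. \<alpha> vs (t - i + 1)) else (\<lambda>vs. \<beta> vs (t - q + 1)))"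
  have "alternating_form (k + 1) g"
    using t i alternating_form_component[OF \<beta>] alternating_form_component[OF \<alpha>]
    by (auto simp: g_def)
  then show "alternating_form (k + 1) (\<lambda>vs. insert_components k p q i \<beta> \<alpha> vs t)"
    using t by (subst alternating_form_cong[where g = g]) (auto simp: insert_components_def g_def)
next
  fix j assume j: "j \<in> {1..q}"
  show "\<exists>t\<in>{1..p + q - 1}. \<forall>vs\<in>tuples (k + 1). insert_components k p q i \<beta> \<alpha> vs t = \<alpha> vs j"
    by (rule bexI[where x = "i + j - 1"]) (use i j in \<open>auto simp: insert_components_def\<close>)
qed

section \<open>Action, equivariance and associativity\<close>

lemma permute_components_id:
  assumes "\<alpha> \<in> plectic_forms k m"
  shows "permute_components k m \<alpha> id = \<alpha>"
  using plectic_form_outside_tuples[OF assms] plectic_form_outside_index[OF assms]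
  by (auto simp: permute_components_def fun_eq_iff restrict_def)

lemma permute_components_comp:
  assumes "\<tau> permutes {1..m}"
  shows "permute_components k m \<alpha> (\<sigma> \<circ> \<tau>) =
    permute_components k m (permute_components k m \<alpha> \<sigma>) \<tau>"
  using permutes_in_image[OF assms]
  by (auto simp: permute_components_def fun_eq_iff restrict_def)

lemma insert_components_permute_right:
  assumes i: "1 \<le> i" "i \<le> p" and \<sigma>: "\<sigma> permutes {1..q}"
  shows "insert_components k p q i \<beta> (permute_components k q \<alpha> \<sigma>) =
    permute_components k (p + q - 1) (insert_components k p q i \<beta> \<alpha>) (local_perm i q \<sigma>)"
proof (intro ext)
  fix vs t
  \<comment> \<open>The permuted position stays inside the inserted block, so the composition still
    reads \<open>\<alpha>\<close> there.\<close>
  have \<sigma>_in: "1 \<le> \<sigma> (t - i + 1) \<and> \<sigma> (t - i + 1) \<le> q" if "i \<le> t" "t < i + q"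
    using that permutes_in_image[OF \<sigma>, of "t - i + 1"] by auto
  show "insert_components k p q i \<beta> (permute_components k q \<alpha> \<sigma>) vs t =
    permute_components k (p + q - 1) (insert_components k p q i \<beta> \<alpha>) (local_perm i q \<sigma>) vs t"
  proof (cases "i \<le> t \<and> t < i + q")
    case True
    with \<sigma>_in i show ?thesis
      by (auto simp: insert_components_def permute_components_def local_perm_def restrict_def)
  next
    case False
    then show ?thesis
      by (auto simp: insert_components_def permute_components_def local_perm_def restrict_def)
  qed
qed

text \<open>Both sides read the same entry at \<open>t\<close>: a singleton block \<open>j\<close>
  carries component \<open>\<sigma> j\<close> of \<open>\<beta>\<close>, and the long block carries
  \<open>\<alpha>\<close> in unchanged order, now inserted at slot
  \<open>\<sigma> i\<close>.\<close>

lemma insert_components_permute_left: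
  assumes i: "1 \<le> i" "i \<le> p" and q: "q \<ge> 1" and \<sigma>: "\<sigma> permutes {1..p}"
  shows "insert_components k p q i (permute_components k p \<beta> \<sigma>) \<alpha> =
    permute_components k (p + q - 1) (insert_components k p q (\<sigma> i) \<beta> \<alpha>) (block_perm i q \<sigma>)"
proof (intro ext)
  fix vs t
  have \<sigma>_in: "1 \<le> \<sigma> j \<and> \<sigma> j \<le> p" if "1 \<le> j" "j \<le> p" for j
    using that permutes_in_image[OF \<sigma>, of j] by auto
  \<comment> \<open>Injectivity keeps singleton blocks away from the long block at
    \<open>\<sigma> i\<close>.\<close>
  have \<sigma>_eq: "\<sigma> j = \<sigma> i \<longleftrightarrow> j = i" for j
    using permutes_inj[OF \<sigma>] by (auto simp: inj_def)
  show "insert_components k p q i (permute_components k p \<beta> \<sigma>) \<alpha> vs t =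
    permute_components k (p + q - 1) (insert_components k p q (\<sigma> i) \<beta> \<alpha>) (block_perm i q \<sigma>) vs t"
  proof (cases "vs \<in> tuples (k + 1) \<and> t \<in> {1..p + q - 1}")
    case True
    then have vs: "vs \<in> tuples (k + 1)" and t: "1 \<le> t" "t \<le> p + q - 1" by auto
    \<comment> \<open>The block containing \<open>t\<close> has number \<open>t\<close>,
      \<open>i\<close> and \<open>t - q + 1\<close> respectively.\<close>
    consider (before) "t < i" | (inside) "i \<le> t" "t < i + q" | (after) "i + q \<le> t"
      by linarith
    then show ?thesis
    proof cases
      case before
      with vs t i q \<sigma>_in[of t] \<sigma>_in[of i] \<sigma>_eq[of t] show ?thesis
        by (auto simp: insert_components_def permute_components_def block_perm_def block_of_def
            block_start_def Let_def)
    next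
      case inside
      with vs t i q \<sigma>_in[of i] show ?thesis
        by (auto simp: insert_components_def permute_components_def block_perm_def block_of_def
            block_start_def Let_def)
    next
      case after
      with vs t i q \<sigma>_in[of "t - q + 1"] \<sigma>_in[of i] \<sigma>_eq[of "t - q + 1"] show ?thesis
        by (auto simp: insert_components_def permute_components_def block_perm_def block_of_def
            block_start_def Let_def)
    qed
  qed (auto simp: insert_components_def permute_components_def restrict_def)
qed

text \<open>Both sides list five segments: \<open>f\<close> before slot \<open>i\<close>, then
  \<open>g\<close>, \<open>f\<close> strictly between the slots, \<open>h\<close>, and the rest of
  \<open>f\<close>. Inserting \<open>g\<close> first shifts slot \<open>j\<close> by
  \<open>m - 1\<close>.\<close>

lemma insert_components_parallel:
  assumes "m \<ge> 1" "r \<ge> 1" "1 \<le> i" "i < j" "j \<le> l"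
  shows "insert_components k (l + r - 1) m i (insert_components k l r j f h) g =
    insert_components k (l + m - 1) r (j - 1 + m) (insert_components k l m i f g) h"
proof (intro ext)
  fix vs t
  consider "t < i" | "i \<le> t" "t < i + m" | "i + m \<le> t" "t < j - 1 + m"
    | "j - 1 + m \<le> t" "t < j - 1 + m + r" | "j - 1 + m + r \<le> t"
    by linarith
  then show "insert_components k (l + r - 1) m i (insert_components k l r j f h) g vs t =
    insert_components k (l + m - 1) r (j - 1 + m) (insert_components k l m i f g) h vs t"
    using assms
    by cases (auto simp: insert_components_def restrict_def ac_simps)
qed

text \<open>Again five segments, now nested: \<open>f\<close>, the start of \<open>g\<close>,
  \<open>h\<close>, the rest of \<open>g\<close>, the rest of \<open>f\<close>.\<close>

lemma insert_components_sequential: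
  assumes "m \<ge> 1" "r \<ge> 1" "1 \<le> i" "i \<le> l" "1 \<le> j" "j \<le> m"
  shows "insert_components k l (m + r - 1) i f (insert_components k m r j g h) =
    insert_components k (l + m - 1) r (i - 1 + j) (insert_components k l m i f g) h"
proof (intro ext)
  fix vs t
  consider "t < i" | "i \<le> t" "t < i - 1 + j" | "i - 1 + j \<le> t" "t < i - 1 + j + r"
    | "i - 1 + j + r \<le> t" "t < i + m + r - 1" | "i + m + r - 1 \<le> t"
    by linarith
  then show "insert_components k l (m + r - 1) i f (insert_components k m r j g h) vs t =
    insert_components k (l + m - 1) r (i - 1 + j) (insert_components k l m i f g) h vs t"
    using assms
    by cases (auto simp: insert_components_def restrict_def ac_simps)
qed

theorem plectic_operad:
  "non_unital_operad (plectic_forms k) (permute_components k) (insert_components k)"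
  by unfold_locales
    (rule permute_components_closed permute_components_id permute_components_comp
      insert_components_closed insert_components_permute_right insert_components_permute_left
      insert_components_parallel insert_components_sequential; simp)+

subsection \<open>The entropy\<close>

text \<open>Composition trades the one entry \<open>\<beta> vs i\<close> for all entries of
  \<open>\<alpha>\<close>. A general \<open>F\<close> serves both the total weight and the sum of w
  ln w.\<close>

lemma sum_insert_components:
  fixes F :: "real \<Rightarrow> real"
  assumes vs: "vs \<in> tuples (k + 1)" and i: "1 \<le> i" "i \<le> p"
  shows "(\<Sum>t=1..p + q - 1. F (insert_components k p q i \<beta> \<alpha> vs t)) =
    (\<Sum>j=1..p. F (\<beta> vs j)) - F (\<beta> vs i) + (\<Sum>j=1..q. F (\<alpha> vs j))"
proof -
  let ?G = "\<lambda>t. F (insert_components k p q i \<beta> \<alpha> vs t)"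
  have "{1..p + q - 1} = {1..<i} \<union> ({i..<i + q} \<union> {i + q..<p + q})"
    using i by auto
  then have "sum ?G {1..p + q - 1} = sum ?G {1..<i} + (sum ?G {i..<i + q} + sum ?G {i + q..<p + q})"
    by (simp only:) (subst sum.union_disjoint; auto simp: sum.union_disjoint)
  also have "sum ?G {1..<i} = (\<Sum>j=1..<i. F (\<beta> vs j))"
    using vs i by (intro sum.cong) (auto simp: insert_components_def)
  also have "sum ?G {i..<i + q} = (\<Sum>j=1..q. F (\<alpha> vs j))"
    using vs i
    by (intro sum.reindex_bij_witness[where i = "\<lambda>j. j + i - 1" and j = "\<lambda>t. t - i + 1"])
      (auto simp: insert_components_def)
  also have "sum ?G {i + q..<p + q} = (\<Sum>j=i + 1..p. F (\<beta> vs j))"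
    using vs i
    by (intro sum.reindex_bij_witness[where i = "\<lambda>j. j + q - 1" and j = "\<lambda>t. t - q + 1"])
      (auto simp: insert_components_def)
  \<comment> \<open>Isolates the term at \<open>i\<close>, the one missing from the three segments
    computed above.\<close>
  also have "(\<Sum>j=1..p. F (\<beta> vs j)) =
      (\<Sum>j=1..<i. F (\<beta> vs j)) + (F (\<beta> vs i) + (\<Sum>j=i + 1..p. F (\<beta> vs j)))"
  proof -
    have "{1..p} = {1..<i} \<union> ({i} \<union> {i + 1..p})"
      using i by auto
    then show ?thesis
      by (simp only:) (subst sum.union_disjoint; auto simp: sum.union_disjoint)
  qed
  ultimately show ?thesis
    by simp
qed

section \<open>Entropy of a single column\<close>

lemma sum_squares_pos:
  fixes x :: "nat \<Rightarrow> real"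
  assumes "q \<ge> 1" "\<And>j. j \<in> {1..q} \<Longrightarrow> x j \<noteq> 0"
  shows "(\<Sum>j=1..q. (x j)\<^sup>2) > 0"
  using assms by (intro sum_pos) auto

text \<open>Split the logarithm of each quotient, using that the weights are positive; the
  normalized weights sum to 1, so ln W is collected exactly once.\<close>

lemma entropy_eq:
  assumes q: "q \<ge> 1" and nz: "\<And>j. j \<in> {1..q} \<Longrightarrow> \<alpha> vs j \<noteq> 0"
  shows "entropy q \<alpha> vs = ln (\<Sum>j=1..q. (\<alpha> vs j)\<^sup>2) -
    (\<Sum>j=1..q. (\<alpha> vs j)\<^sup>2 * ln ((\<alpha> vs j)\<^sup>2)) / (\<Sum>j=1..q. (\<alpha> vs j)\<^sup>2)"
proof -
  define W where "W = (\<Sum>j=1..q. (\<alpha> vs j)\<^sup>2)"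
  have W: "W > 0"
    unfolding W_def using q nz by (rule sum_squares_pos)
  have "(\<Sum>j=1..q. (\<alpha> vs j)\<^sup>2 / W * ln ((\<alpha> vs j)\<^sup>2 / W)) =
      (\<Sum>j=1..q. (\<alpha> vs j)\<^sup>2 * ln ((\<alpha> vs j)\<^sup>2) / W - (\<alpha> vs j)\<^sup>2 * (ln W / W))"
    using W nz by (intro sum.cong refl) (simp add: ln_div field_simps)
  also have "\<dots> = (\<Sum>j=1..q. (\<alpha> vs j)\<^sup>2 * ln ((\<alpha> vs j)\<^sup>2)) / W - W * (ln W / W)"
    by (simp only: sum_subtractf sum_divide_distrib sum_distrib_right W_def)
  finally show ?thesis
    unfolding entropy_def W_def[symmetric] using W by simp
qed

text \<open>Each normalized weight lies between 0 and 1, so its logarithm is nonpositive. The sign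
  is used in (b) to replace the factor S / T by 1.\<close>

lemma entropy_nonneg:
  assumes q: "q \<ge> 1" and nz: "\<And>j. j \<in> {1..q} \<Longrightarrow> \<alpha> vs j \<noteq> 0"
  shows "entropy q \<alpha> vs \<ge> 0"
proof -
  define W where "W = (\<Sum>j=1..q. (\<alpha> vs j)\<^sup>2)"
  have W: "W > 0"
    unfolding W_def using q nz by (rule sum_squares_pos)
  have "(\<alpha> vs j)\<^sup>2 / W * ln ((\<alpha> vs j)\<^sup>2 / W) \<le> 0" if j: "j \<in> {1..q}" for j
  proof (rule mult_nonneg_nonpos)
    have "(\<alpha> vs j)\<^sup>2 \<le> W"
      unfolding W_def using j by (intro member_le_sum) auto
    then show "ln ((\<alpha> vs j)\<^sup>2 / W) \<le> 0"
      using W nz[OF j] by simp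
  qed (use W in simp)
  then show ?thesis
    unfolding entropy_def W_def[symmetric] by (intro iffD2[OF neg_0_le_iff_le] sum_nonpos)
qed

section \<open>Entropy of a composition\<close>

lemma insert_components_nonzero:
  assumes "vs \<in> tuples (k + 1)" "1 \<le> i" "i \<le> p" "t \<in> {1..p + q - 1}"
    and "\<And>j. j \<in> {1..p} \<Longrightarrow> \<beta> vs j \<noteq> 0" "\<And>j. j \<in> {1..q} \<Longrightarrow> \<alpha> vs j \<noteq> 0"
  shows "insert_components k p q i \<beta> \<alpha> vs t \<noteq> 0"
  using assms by (auto simp: insert_components_def)

lemma entropy_insert_components:
  fixes \<alpha> \<beta> :: "'v list \<Rightarrow> nat \<Rightarrow> real"
  assumes vs: "vs \<in> tuples (k + 1)" and i: "1 \<le> i" "i \<le> p" and q: "q \<ge> 1"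
    and nz: "\<And>j. j \<in> {1..p} \<Longrightarrow> \<beta> vs j \<noteq> 0" "\<And>j. j \<in> {1..q} \<Longrightarrow> \<alpha> vs j \<noteq> 0"
  defines "T \<equiv> (\<Sum>j=1..p. (\<beta> vs j)\<^sup>2) - (\<beta> vs i)\<^sup>2 + (\<Sum>j=1..q. (\<alpha> vs j)\<^sup>2)"
  shows "entropy (p + q - 1) (insert_components k p q i \<beta> \<alpha>) vs =
    ln T - ((\<Sum>j=1..p. (\<beta> vs j)\<^sup>2 * ln ((\<beta> vs j)\<^sup>2)) - (\<beta> vs i)\<^sup>2 * ln ((\<beta> vs i)\<^sup>2)
      + (\<Sum>j=1..q. (\<alpha> vs j)\<^sup>2 * ln ((\<alpha> vs j)\<^sup>2))) / T"
proof -
  have "entropy (p + q - 1) (insert_components k p q i \<beta> \<alpha>) vs =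
    ln (\<Sum>t=1..p + q - 1. (insert_components k p q i \<beta> \<alpha> vs t)\<^sup>2) -
    (\<Sum>t=1..p + q - 1. (insert_components k p q i \<beta> \<alpha> vs t)\<^sup>2 *
        ln ((insert_components k p q i \<beta> \<alpha> vs t)\<^sup>2)) /
    (\<Sum>t=1..p + q - 1. (insert_components k p q i \<beta> \<alpha> vs t)\<^sup>2)"
    using i q insert_components_nonzero[where \<alpha> = \<alpha> and \<beta> = \<beta>, OF vs i _ nz]
    by (intro entropy_eq) auto
  then show ?thesis
    unfolding T_def
      sum_insert_components[OF vs i, where F = "\<lambda>x. x\<^sup>2"]
      sum_insert_components[OF vs i, where F = "\<lambda>x. x\<^sup>2 * ln (x\<^sup>2)"] .
qed

text \<open>The three terms of the exact formula are bounded separately: the first by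
  \<open>T \<le> 2 * S\<close>, the second by \<open>S \<le> T\<close> and \<open>E \<ge> 0\<close>,
  the third by \<open>x \<le> S\<close>.\<close>

lemma entropy_insert_self_le:
  assumes vs: "vs \<in> tuples (k + 1)" and i: "1 \<le> i" "i \<le> q"
    and nz: "\<And>j. j \<in> {1..q} \<Longrightarrow> \<alpha> vs j \<noteq> 0"
  shows "entropy (q + q - 1) (insert_components k q q i \<alpha> \<alpha>) vs \<le> 2 * entropy q \<alpha> vs + ln 2"
proof -
  define S where "S = (\<Sum>j=1..q. (\<alpha> vs j)\<^sup>2)"
  define h where "h = (\<Sum>j=1..q. (\<alpha> vs j)\<^sup>2 * ln ((\<alpha> vs j)\<^sup>2))"
  define x where "x = (\<alpha> vs i)\<^sup>2"
  define E where "E = entropy q \<alpha> vs"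
  define T where "T = S - x + S"
  have q: "q \<ge> 1"
    using i by simp
  have S: "S > 0"
    unfolding S_def using q nz by (rule sum_squares_pos)
  have x: "0 < x" "x \<le> S"
    using i nz[of i] member_le_sum[of i "{1..q}" "\<lambda>j. (\<alpha> vs j)\<^sup>2"]
    by (auto simp: x_def S_def)
  have T: "S \<le> T" "T \<le> 2 * S" "T > 0"
    using x by (auto simp: T_def)
  have E: "E \<ge> 0"
    unfolding E_def using q nz by (rule entropy_nonneg)
  have "E = ln S - h / S"
    unfolding E_def S_def h_def using q nz by (rule entropy_eq)
  \<comment> \<open>Eliminating \<open>h\<close> leaves an expression in \<open>S\<close>,
    \<open>x\<close> and \<open>E\<close> alone.\<close>
  then have h: "h = S * (ln S - E)"
    using S by (simp add: field_simps)
  have "entropy (q + q - 1) (insert_components k q q i \<alpha> \<alpha>) vs = ln T - (h - x * ln x + h) / T"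
    unfolding T_def S_def x_def h_def using vs i q nz nz by (rule entropy_insert_components)
  also have "\<dots> = ln T - ln S + 2 * (S / T * E) + x / T * (ln x - ln S)"
  proof -
    \<comment> \<open>The coefficient 2S of ln S is written as \<open>T + x\<close>, so that
      division by \<open>T\<close> splits off a full ln S.\<close>
    have "(h - x * ln x + h) / T =
        ((T + x) * ln S - 2 * (S * E) - x * ln x) / T"
      unfolding h T_def by (simp add: algebra_simps)
    also have "\<dots> = ln S + x / T * ln S - 2 * (S / T * E) - x / T * ln x"
      using T(3) by (simp add: add_divide_distrib diff_divide_distrib distrib_right)
    finally show ?thesis
      by (simp add: right_diff_distrib)
  qed
  also have "\<dots> \<le> ln 2 + 2 * E + 0"
  proof (intro add_mono)
    have "ln T \<le> ln (2 * S)"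
      using T by simp
    then show "ln T - ln S \<le> ln 2"
      using S by (simp add: ln_mult)
    have "S / T * E \<le> 1 * E"
      using T E by (intro mult_right_mono) simp_all
    then show "2 * (S / T * E) \<le> 2 * E"
      by linarith
    show "x / T * (ln x - ln S) \<le> 0"
      using x S T by (intro mult_nonneg_nonpos) auto
  qed
  finally show ?thesis
    by (simp add: E_def)
qed

text \<open>The total weight stays \<open>B\<close>, while \<open>b\<close> loses A ln A and gains
  \<open>a\<close>. The change (A ln A - a) / B is A / B times ln A - a / A, the entropy of
  \<open>\<alpha>\<close>.\<close>

lemma entropy_insert_eq:
  fixes \<alpha> \<beta> :: "'v list \<Rightarrow> nat \<Rightarrow> real"
  assumes vs: "vs \<in> tuples (k + 1)" and i: "1 \<le> i" "i \<le> p" and q: "q \<ge> 1"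
    and nz: "\<And>j. j \<in> {1..p} \<Longrightarrow> \<beta> vs j \<noteq> 0" "\<And>j. j \<in> {1..q} \<Longrightarrow> \<alpha> vs j \<noteq> 0"
    and eq: "(\<beta> vs i)\<^sup>2 = (\<Sum>j=1..q. (\<alpha> vs j)\<^sup>2)"
  shows "entropy (p + q - 1) (insert_components k p q i \<beta> \<alpha>) vs =
    entropy p \<beta> vs + (\<Sum>j=1..q. (\<alpha> vs j)\<^sup>2) / (\<Sum>j=1..p. (\<beta> vs j)\<^sup>2) * entropy q \<alpha> vs"
proof -
  have p: "p \<ge> 1"
    using i by simp
  define A where "A = (\<Sum>j=1..q. (\<alpha> vs j)\<^sup>2)"
  define B where "B = (\<Sum>j=1..p. (\<beta> vs j)\<^sup>2)"
  define a where "a = (\<Sum>j=1..q. (\<alpha> vs j)\<^sup>2 * ln ((\<alpha> vs j)\<^sup>2))"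
  define b where "b = (\<Sum>j=1..p. (\<beta> vs j)\<^sup>2 * ln ((\<beta> vs j)\<^sup>2))"
  have pos: "A > 0" "B > 0"
    unfolding A_def B_def using p q nz by (blast intro: sum_squares_pos)+
  have "entropy (p + q - 1) (insert_components k p q i \<beta> \<alpha>) vs =
      ln (B - A + A) - (b - A * ln A + a) / (B - A + A)"
    unfolding A_def B_def a_def b_def using vs i q nz by (subst entropy_insert_components) (simp_all add: eq)
  moreover have "entropy p \<beta> vs = ln B - b / B"
    unfolding B_def b_def using p nz(1) by (rule entropy_eq)
  moreover have "entropy q \<alpha> vs = ln A - a / A"
    unfolding A_def a_def using q nz(2) by (rule entropy_eq)
  ultimately show ?thesis
    unfolding A_def[symmetric] B_def[symmetric] using pos by (simp add: field_simps)
qed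

text \<open>The common value cancels, leaving the uniform distribution with all weights 1 /
  q.\<close>

lemma entropy_constant_column:
  assumes "vs \<in> tuples (k + 1)" "\<gamma> vs \<noteq> 0" "q \<ge> 1"
  shows "entropy q (constant_column k q \<gamma>) vs = ln (real q)"
  using assms by (simp add: entropy_def constant_column_def ln_div)

text \<open>The space V is the whole type \<open>'v\<close>. As \<open>dim\<close> is 0 in the
  absence of a finite basis, \<open>n \<ge> 2\<close> makes V finite-dimensional. The four conjuncts
  are (a) to (d).\<close>

theorem theorem3p3:
  fixes n k :: nat
  assumes "n \<ge> 2" and "1 \<le> k" and "k \<le> n - 1"
    and "dim (UNIV :: 'v::real_vector set) = n"
  shows
    "non_unital_operad (plectic_forms k :: nat \<Rightarrow> ('v list \<Rightarrow> nat \<Rightarrow> real) set)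
       (permute_components k) (insert_components k)
     \<and>
     (\<forall>q\<ge>2. \<forall>\<alpha>\<in>plectic_forms k q. \<forall>i\<in>{1..q}. \<forall>vs::'v list\<in>tuples (k + 1).
        (\<forall>j\<in>{1..q}. \<alpha> vs j \<noteq> 0) \<longrightarrow>
        entropy (q + q - 1) (insert_components k q q i \<alpha> \<alpha>) vs \<le> 2 * entropy q \<alpha> vs + ln 2)
     \<and>
     (\<forall>p\<ge>2. \<forall>q\<ge>2. \<forall>\<beta>\<in>plectic_forms k p. \<forall>\<alpha>\<in>plectic_forms k q. \<forall>i\<in>{1..p}.
        \<forall>vs::'v list\<in>tuples (k + 1).
        (\<forall>j\<in>{1..p}. (\<beta> vs j)\<^sup>2 \<noteq> 0) \<and> (\<forall>j\<in>{1..q}. (\<alpha> vs j)\<^sup>2 \<noteq> 0) \<and>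
        (\<beta> vs i)\<^sup>2 = (\<Sum>j=1..q. (\<alpha> vs j)\<^sup>2) \<longrightarrow>
        entropy (p + q - 1) (insert_components k p q i \<beta> \<alpha>) vs
        = entropy p \<beta> vs
          + (\<Sum>j=1..q. (\<alpha> vs j)\<^sup>2) / (\<Sum>j=1..p. (\<beta> vs j)\<^sup>2) * entropy q \<alpha> vs)
     \<and>
     (\<forall>q\<ge>2. \<forall>\<gamma>. constant_column k q \<gamma> \<in> plectic_forms k q \<longrightarrow>
        (\<forall>vs::'v list\<in>tuples (k + 1). \<gamma> vs \<noteq> 0 \<longrightarrow>
           entropy q (constant_column k q \<gamma>) vs = ln (real q)))"
proof (intro conjI ballI allI impI, goal_cases)
  case 1
  show ?case
    by (rule plectic_operad)
next
  case (2 q \<alpha> i vs)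
  then show ?case
    by (intro entropy_insert_self_le) simp_all
next
  case (3 p q \<beta> \<alpha> i vs)
  then show ?case
    by (intro entropy_insert_eq) simp_all
next
  case (4 q \<gamma> vs)
  then show ?case
    by (intro entropy_constant_column) simp_all
qed

end
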